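(* Let $a$ be any type (set), let $xs$ be a finite list over $a$, and let $k$ be a natural number with $2\le 1+k\le \mathrm{length}(xs)$. Then $$\mathit{up}\,(\mathit{ch}\;k\;xs)\;=\;\mathrm{map}_B\;\mathit{subs}\;(\mathit{ch}\;(1+k)\;xs),$$ where $\mathit{up}$, $\mathit{ch}$, $\mathit{subs}$ and $\mathrm{map}_B$ are the functions defined in the context. Since $\mathit{up}$ is a partial function, the equation includes the assertion that its left-hand side is defined.
   Context: $L\,a$ is the type of finite lists over $a$; $x:xs$ is cons, $\mathbin{+\!\!+}$ is list append, $\mathrm{map}_L$ is the map function of lists. Immediate sublists, $\mathit{subs}: L\,a\to L(L\,a)$: - $\mathit{subs}\;[\,]=[\,]$, - $\mathit{subs}\;(x:xs)=\mathrm{map}_L\,(x:)\,(\mathit{subs}\;xs)\mathbin{+\!\!+}[xs]$. Trees: $B\,a$ is the inductive type of tip-valued binary trees with constructors $T: a\to B\,a$ and $N: B\,a\to B\,a\to B\,a$. $\mathrm{map}_B\,f$ applies $f$ to the value at every tip. $\mathit{zipBW}: (a\to b\to c)\to B\,a\to B\,b\to B\,c$ combines two trees of the same shape by applying the given function to the values at corresponding tips; it is undefined if the shapes differ. $\mathit{unT}\,(T\,p)=p$ (undefined on $N$-trees). $\mathit{snoc}\;ys\;z=ys\mathbin{+\!\!+}[z]$. In all definitions, clauses are tried from top to bottom and the first matching one applies. $\mathit{ch}:\mathbb N\to L\,a\to B(L\,a)$, with $\mathit{ch}\;k\;xs$ defined when $k\le\mathrm{length}(xs)$: - $\mathit{ch}\;0\;xs=T\,[\,]$,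 - $\mathit{ch}\;k\;xs=T\,xs$ if $k=\mathrm{length}(xs)$, - $\mathit{ch}\;(1+k)\;(x:xs)=N\,(\mathrm{map}_B\,(x:)\,(\mathit{ch}\;k\;xs))\,(\mathit{ch}\;(1+k)\;xs)$. The partial function $\mathit{up}: B\,a\to B(L\,a)$ (polymorphic in $a$): - $\mathit{up}\,(N\,(T\,p)\,(T\,q))=T\,[p,q]$, - $\mathit{up}\,(N\,t\,(T\,q))=T\,(\mathit{unT}(\mathit{up}\,t)\mathbin{+\!\!+}[q])$, - $\mathit{up}\,(N\,(T\,p)\,u)=N\,(\mathrm{map}_B\,(\lambda q.\,[p,q])\,u)\,(\mathit{up}\,u)$, - $\mathit{up}\,(N\,t\,u)=N\,(\mathit{zipBW}\;\mathit{snoc}\;(\mathit{up}\,t)\;u)\,(\mathit{up}\,u)$, and $\mathit{up}\,(T\,p)$ is undefined. In $\mathit{up}\,(\mathit{ch}\;k\;xs)$, $\mathit{up}$ is used at element type $L\,a$. *)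

theory Defs
  imports Main "HOL-Library.Monad_Syntax"
begin

(* Partial functions are rendered as option-valued functions, None meaning "undefined".
   They are strict: a value is defined only if all its parts are. *)

fun subs :: "'a list \<Rightarrow> 'a list list" where
  "subs [] = []"
| "subs (x # xs) = map (Cons x) (subs xs) @ [xs]"

datatype 'a B = T 'a | N "'a B" "'a B"

fun zipBW :: "('a \<Rightarrow> 'b \<Rightarrow> 'c) \<Rightarrow> 'a B \<Rightarrow> 'b B \<Rightarrow> 'c B option" where
  "zipBW f (T p) (T q) = Some (T (f p q))"
| "zipBW f (N t u) (N t' u') = do { v \<leftarrow> zipBW f t t'; w \<leftarrow> zipBW f u u'; Some (N v w) }"
| "zipBW f _ _ = None"

fun unT :: "'a B \<Rightarrow> 'a option" where
  "unT (T p) = Some p"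
| "unT (N t u) = None"

definition snoc :: "'a list \<Rightarrow> 'a \<Rightarrow> 'a list" where
  "snoc ys z = ys @ [z]"

(* The clause guarded by k = length xs can only apply to positive k when xs is nonempty,
   so it is folded into the last equation; see also ch_length and ch_defined_iff. *)
fun ch :: "nat \<Rightarrow> 'a list \<Rightarrow> 'a list B option" where
  "ch 0 xs = Some (T [])"
| "ch (Suc k) [] = None"
| "ch (Suc k) (x # xs) =
     (if Suc k = length (x # xs) then Some (T (x # xs))
      else do { t \<leftarrow> ch k xs; u \<leftarrow> ch (Suc k) xs; Some (N (map_B (Cons x) t) u) })"

lemma ch_length: "ch (length xs) xs = Some (T xs)"
  by (cases xs) simp_all

lemma ch_defined_iff: "ch k xs \<noteq> None \<longleftrightarrow> k \<le> length xs"
  by (induction k xs rule: ch.induct) (auto split: Option.bind_splits)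

fun up :: "'a B \<Rightarrow> 'a list B option" where
  "up (N (T p) (T q)) = Some (T [p, q])"
| "up (N t (T q)) = do { t' \<leftarrow> up t; ps \<leftarrow> unT t'; Some (T (ps @ [q])) }"
| "up (N (T p) u) = do { u' \<leftarrow> up u; Some (N (map_B (\<lambda>q. [p, q]) u) u') }"
| "up (N t u) = do { t' \<leftarrow> up t; v \<leftarrow> zipBW snoc t' u; u' \<leftarrow> up u; Some (N v u') }"
| "up (T p) = None"

end

theory Submission imports Defs begin

text \<open>
  Induction on the list. For \<open>xs = x # ys\<close> and \<open>0 < j\<close>, the left subtree of \<open>ch (Suc j) xs\<close> is
  \<open>map_B (Cons x) (ch j ys)\<close>. Naturality of \<open>up\<close> moves \<open>map_B (Cons x)\<close> outside, so the induction
  hypothesis turns this subtree into the image of \<open>ch (Suc j) ys\<close> under \<open>map (Cons x) \<circ> subs\<close>; zipping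
  with \<open>ch (Suc j) ys\<close> itself, which is the right subtree, appends the last immediate sublist.
\<close>

lemma zipBW_map_B:
  "zipBW h (map_B f t) (map_B g u) = zipBW (\<lambda>p q. h (f p) (g q)) t u"
  by (induction t arbitrary: u; case_tac u) simp_all

lemma map_B_zipBW:
  "zipBW (\<lambda>p q. f (h p q)) t u = map_option (map_B f) (zipBW h t u)"
  by (induction h t u rule: zipBW.induct) (auto split: Option.bind_splits)

lemma zipBW_same: "zipBW h t t = Some (map_B (\<lambda>p. h p p) t)"
  by (induction t) simp_all

lemma unT_map_B: "unT (map_B f t) = map_option f (unT t)"
  by (cases t) simp_all

text \<open>\<open>map f\<close> commutes with appending a last element, so relabelling passes
  through this zip.\<close>

lemma zipBW_snoc_map_B:
  "zipBW snoc (map_B (map f) t) (map_B f u) = map_option (map_B (map f)) (zipBW snoc t u)"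
  by (simp add: zipBW_map_B snoc_def flip: map_B_zipBW)

text \<open>\<open>up\<close> selects its clause by shape alone, which \<open>map_B f\<close>
  preserves, and never inspects labels. The case distinctions follow the clauses of
  \<open>up\<close>; \<open>map_option\<close> also records that both sides are undefined
  together.\<close>

lemma up_map_B: "up (map_B f t) = map_option (map_B (map f)) (up t)"
proof (induction t)
  case (T p)
  show ?case by simp
next
  case (N t u)
  show ?case
  proof (cases t)
    case t: (T p)
    show ?thesis
    proof (cases u)
      case (T q)
      with t show ?thesis by simp
    next
      case (N u1 u2)
      with t N.IH(2) show ?thesis
        by (cases "up u") (simp_all add: B.map_comp comp_def)
    qed
  next
    case t: (N t1 t2)
    show ?thesis
    proof (cases u)
      case (T q)
      with t N.IH(1) show ?thesis
        by (cases "up t") (auto simp: unT_map_B split: Option.bind_split)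
    next
      case u: (N u1 u2)
      show ?thesis
      proof (cases "up t")
        case None
        with t u N.IH(1) show ?thesis by simp
      next
        case (Some t')
        with t u N.IH zipBW_snoc_map_B[of f t' u] show ?thesis
          by (cases "zipBW snoc t' u"; cases "up u") simp_all
      qed
    qed
  qed
qed

lemma ch_SomeE:
  assumes "k \<le> length xs"
  obtains t where "ch k xs = Some t"
  using assms ch_defined_iff by blast

text \<open>Serves to decide which clause of \<open>up\<close> applies to a tree built by
  \<open>ch\<close>.\<close>

lemma ch_NE:
  assumes "0 < k" "k < length xs"
  obtains l r where "ch k xs = Some (N l r)"
proof -
  obtain j where k: "k = Suc j"
    using assms(1) gr0_implies_Suc by blast
  obtain x ys where xs: "xs = x # ys"
    using assms(2) by (cases xs) auto
  obtain l where "ch j ys = Some l"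
    using ch_SomeE[of j ys] assms(2) k xs by auto
  moreover obtain r where "ch (Suc j) ys = Some r"
    using ch_SomeE[of "Suc j" ys] assms(2) k xs by auto
  ultimately have "ch k xs = Some (N (map_B (Cons x) l) r)"
    using assms(2) k xs by simp
  then show thesis
    using that by blast
qed

lemma length_of_ch:
  assumes "ch k xs = Some t" "ys \<in> set_B t"
  shows "length ys = k"
  using assms
proof (induction k xs arbitrary: t ys rule: ch.induct)
  case (1 xs)
  then show ?case by auto
next
  case (2 k)
  then show ?case by simp
next
  case (3 k x xs)
  show ?case
  proof (cases "k = length xs")
    case True
    with "3.prems" show ?thesis by auto
  next
    case False
    then obtain l r where l: "ch k xs = Some l" and r: "ch (Suc k) xs = Some r"
      and t: "t = N (map_B (Cons x) l) r"
      using "3.prems"(1) by (auto split: Option.bind_splits)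
    from False have ne: "Suc k \<noteq> length (x # xs)"
      by simp
    consider zs where "ys = x # zs" "zs \<in> set_B l" | "ys \<in> set_B r"
      using "3.prems"(2) t by (auto simp: B.set_map)
    then show ?thesis
      using "3.IH"(1)[OF ne l] "3.IH"(2)[OF ne l r] by cases simp_all
  qed
qed

lemma up_ch:
  assumes "0 < k" "Suc k \<le> length xs" "ch k xs = Some t" "ch (Suc k) xs = Some u"
  shows "up t = Some (map_B subs u)"
  using assms
proof (induction xs arbitrary: k t u)
  case Nil
  then show ?case by simp
next
  case (Cons x ys)
  obtain j where k: "k = Suc j"
    using Cons.prems(1) gr0_implies_Suc by blast
  have len: "Suc j \<le> length ys"
    using Cons.prems(2) k by simp
  obtain l where l: "ch j ys = Some l"
    using ch_SomeE[of j ys] len by auto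
  obtain r where r: "ch (Suc j) ys = Some r"
    using ch_SomeE[OF len] .
  have t: "t = N (map_B (Cons x) l) r"
    using Cons.prems(3) k l r len by simp
  \<comment> \<open>The guard is essential: for \<open>j = 0\<close> the tree \<open>l\<close> is a
    tip, where \<open>up\<close> is undefined.\<close>
  have up_l: "up (map_B (Cons x) l) = Some (map_B (map (Cons x) \<circ> subs) r)" if "0 < j"
    using Cons.IH[OF that len l r] by (simp add: up_map_B B.map_comp)
  \<comment> \<open>The right subtree \<open>r\<close> is a tip iff
    \<open>Suc j = length ys\<close>, the left one iff \<open>j = 0\<close>; the four cases match
    the four defined clauses of \<open>up\<close>.\<close>
  show ?case
  proof (cases "Suc j = length ys")
    case True
    then have rT: "r = T ys"
      using r by (simp add: ch_length)
    have u: "u = T (x # ys)"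
      using Cons.prems(4) k True by simp
    show ?thesis
    proof (cases "j = 0")
      case True
      then obtain y where "ys = [y]"
        using \<open>Suc j = length ys\<close> by (cases ys) auto
      then show ?thesis
        using l True by (auto simp: t u rT)
    next
      case False
      \<comment> \<open>Second clause of \<open>up\<close>: \<open>unT\<close> extracts
        \<open>map (Cons x) (subs ys)\<close>, and appending \<open>ys\<close> gives
        \<open>subs (x # ys)\<close>.\<close>
      then obtain l1 l2 where "l = N l1 l2"
        using ch_NE[of j ys] l len by (metis Suc_le_eq neq0_conv option.inject)
      then show ?thesis
        using up_l False by (simp add: t u rT)
    qed
  next
    case False
    then have len': "Suc j < length ys"
      using len by simp
    obtain w where w: "ch (Suc (Suc j)) ys = Some w"
      using ch_SomeE[of "Suc (Suc j)" ys] len' by auto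
    have u: "u = N (map_B (Cons x) r) w"
      using Cons.prems(4) k r w False by simp
    have up_r: "up r = Some (map_B subs w)"
      using Cons.IH[OF _ _ r w] len' by simp
    obtain r1 r2 where rN: "r = N r1 r2"
      using ch_NE[OF _ len'] r by (metis option.inject zero_less_Suc)
    show ?thesis
    proof (cases "j = 0")
      case True
      \<comment> \<open>For \<open>j = 0\<close> every tip of \<open>r\<close> is a singleton, and
        the left tip becomes \<open>[x]\<close>.\<close>
      have "subs (x # q) = [[x], q]" if "q \<in> set_B r" for q
        using length_of_ch[OF r that] True by (auto simp: length_Suc_conv)
      then have "map_B (\<lambda>q. [[x], q]) r = map_B (subs \<circ> Cons x) r"
        by (intro B.map_cong) simp_all
      moreover have "l = T []"
        using l True by simp
      ultimately show ?thesis
        using up_r by (simp add: t u rN B.map_comp)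
    next
      case False
      then obtain l1 l2 where lN: "l = N l1 l2"
        using ch_NE[of j ys] l len by (metis Suc_le_eq neq0_conv option.inject)
      \<comment> \<open>Reading the second \<open>r\<close> as \<open>map_B id r\<close> makes this
        a zip of \<open>r\<close> with itself; at a tip \<open>q\<close> it yields
        \<open>map (Cons x) (subs q) @ [q]\<close>, which is \<open>subs (x # q)\<close>.\<close>
      have "zipBW snoc (map_B (map (Cons x) \<circ> subs) r) r = Some (map_B (subs \<circ> Cons x) r)"
        using zipBW_map_B[of snoc "map (Cons x) \<circ> subs" r id r]
        by (simp add: B.map_id zipBW_same snoc_def comp_def)
      then show ?thesis
        using up_l False up_r by (simp add: t u lN rN B.map_comp)
    qed
  qed
qed

theorem mainTheorem1:
  fixes xs :: "'a list" and k :: nat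
  assumes "2 \<le> 1 + k" and "1 + k \<le> length xs"
  shows "\<exists>t u. ch k xs = Some t \<and> ch (1 + k) xs = Some u \<and> up t = Some (map_B subs u)"
proof -
  obtain t where "ch k xs = Some t"
    using ch_SomeE[of k xs] assms(2) by auto
  moreover obtain u where "ch (Suc k) xs = Some u"
    using ch_SomeE[of "Suc k" xs] assms(2) by auto
  ultimately show ?thesis
    using up_ch[of k xs t u] assms by auto
qed

end
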